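(* Let $\ell > m > 0$ be integers with $\gcd(\ell,m)=1$, let $n \geq 1$ be an integer, and let $$Z_n(t) := t^n + \sum_{k=1}^{n} (-1)^k \binom{n}{k} t^{n-k} \left(\ell^k + (\ell-m)^k\right).$$ If $2\ell - m$ is singly even (that is, $2 \mid (2\ell-m)$ but $4 \nmid (2\ell-m)$), then $Z_n$ is irreducible over $\mathbb{Z}$.
   Context: A polynomial $f \in \mathbb{Z}[t]$ is called reducible (over $\mathbb{Z}$) if $f = gh$ with $g,h \in \mathbb{Z}[t]$ both of positive degree; otherwise it is called irreducible (over $\mathbb{Z}$). *)

theory Defs
  imports "HOL-Computational_Algebra.Polynomial"
begin

(* Deliberately not the library's irreducible on int poly: only factors of positive degree
   count, so the content of f is irrelevant and constants are never reducible. *)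
definition reducible_over_Z :: "int poly \<Rightarrow> bool" where
  "reducible_over_Z f \<longleftrightarrow> (\<exists>g h. f = g * h \<and> degree g > 0 \<and> degree h > 0)"

definition irreducible_over_Z :: "int poly \<Rightarrow> bool" where
  "irreducible_over_Z f \<longleftrightarrow> \<not> reducible_over_Z f"

definition Z_poly :: "int \<Rightarrow> int \<Rightarrow> nat \<Rightarrow> int poly" where
  "Z_poly l m n = monom 1 n +
     (\<Sum>k=1..n. monom ((-1) ^ k * int (n choose k) * (l ^ k + (l - m) ^ k)) (n - k))"

definition singly_even :: "int \<Rightarrow> bool" where
  "singly_even a \<longleftrightarrow> 2 dvd a \<and> \<not> 4 dvd a"

end

theory Submission
  imports Defs
begin

text \<open>
  For odd \<open>l\<close> and \<open>4 dvd m\<close> the polynomial is Eisenstein at 2: the numbers \<open>l ^ k + (l - m) ^ k\<close> are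
  sums of two odd numbers, and the constant term is, up to sign, \<open>l ^ n + (l - m) ^ n\<close>, which is
  congruent to \<open>2 * l ^ n\<close> and hence to 2 modulo 4.
\<close>

text \<open>Take the least \<open>i\<close> with \<open>coeff g i\<close> not divisible by
  \<open>p\<close>; the leading coefficient of \<open>g\<close> shows that one exists. In
  coefficient \<open>i\<close> of the product, every term except
  \<open>coeff g i * coeff h 0\<close> is divisible by \<open>p\<close>. Since
  \<open>degree h > 0\<close>, this \<open>i\<close> lies below \<open>degree (g * h)\<close>, which
  contradicts \<open>low\<close>.\<close>

lemma Eisenstein_aux:
  fixes g h :: "'a::idom poly"
  assumes p: "prime_elem p"
    and deg: "degree h > 0"
    and lead: "\<not> p dvd lead_coeff (g * h)"
    and low: "\<And>i. i < degree (g * h) \<Longrightarrow> p dvd coeff (g * h) i"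
    and g0: "p dvd coeff g 0" and h0: "\<not> p dvd coeff h 0"
  shows False
proof -
  define i where "i = (LEAST i. \<not> p dvd coeff g i)"
  have g: "\<not> p dvd lead_coeff g"
    using lead by (auto simp: lead_coeff_mult)
  have i: "\<not> p dvd coeff g i"
    unfolding i_def using g by (rule LeastI)
  have "i \<le> degree g"
    unfolding i_def using g by (rule Least_le)
  moreover have "degree (g * h) = degree g + degree h"
    using g deg by (intro degree_mult_eq) auto
  ultimately have "p dvd coeff (g * h) i"
    using deg by (intro low) simp
  moreover have "coeff (g * h) i = (\<Sum>j<i. coeff g j * coeff h (i - j)) + coeff g i * coeff h 0"
    by (simp add: coeff_mult flip: lessThan_Suc_atMost)
  moreover have "p dvd (\<Sum>j<i. coeff g j * coeff h (i - j))"
    using not_less_Least unfolding i_def by (intro dvd_sum) (blast intro: dvd_mult2)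
  ultimately have "p dvd coeff g i * coeff h 0"
    by (simp add: dvd_add_right_iff)
  with p i h0 show False
    by (simp add: prime_elem_dvd_mult_iff)
qed

text \<open>If both degrees were positive, \<open>p\<close> would divide the constant term of the
  product, but \<open>p\<^sup>2\<close> does not, so \<open>p\<close> would divide exactly one of
  the two constant terms. \<open>Eisenstein_aux\<close> covers both cases by symmetry.\<close>

theorem Eisenstein_criterion:
  fixes g h :: "'a::idom poly"
  assumes p: "prime_elem p"
    and lead: "\<not> p dvd lead_coeff (g * h)"
    and low: "\<And>i. i < degree (g * h) \<Longrightarrow> p dvd coeff (g * h) i"
    and const: "\<not> p\<^sup>2 dvd coeff (g * h) 0"
  shows "degree g = 0 \<or> degree h = 0"
proof (rule ccontr)
  assume "\<not> ?thesis"
  hence deg: "degree g > 0" "degree h > 0" by auto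
  have "g \<noteq> 0" "h \<noteq> 0" using deg by auto
  hence "p dvd coeff (g * h) 0"
    using deg by (intro low) (simp add: degree_mult_eq)
  hence "p dvd coeff g 0 \<or> p dvd coeff h 0"
    using p by (simp add: coeff_mult_0 prime_elem_dvd_mult_iff)
  moreover have "\<not> (p dvd coeff g 0 \<and> p dvd coeff h 0)"
    using const by (auto simp: coeff_mult_0 power2_eq_square intro: mult_dvd_mono)
  ultimately show False
    using Eisenstein_aux[of p h g] Eisenstein_aux[of p g h] p deg lead low
    by (auto simp: mult.commute[of h g])
qed

text \<open>The case \<open>i = n\<close> is separate because the general formula would give 2
  there.\<close>

lemma coeff_Z_poly:
  "coeff (Z_poly l m n) i =
     (if i < n then (-1) ^ (n - i) * int (n choose i) * (l ^ (n - i) + (l - m) ^ (n - i))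
      else if i = n then 1 else 0)"
proof -
  let ?c = "\<lambda>k. (-1) ^ k * int (n choose k) * (l ^ k + (l - m) ^ k)"
  have "(\<Sum>k=1..n. coeff (monom (?c k) (n - k)) i) = (\<Sum>k=1..n. if k = n - i \<and> i < n then ?c k else 0)"
    by (rule sum.cong) auto
  also have "\<dots> = (if i < n then ?c (n - i) else 0)"
    by auto
  finally show ?thesis
    by (simp add: Z_poly_def coeff_sum binomial_symmetric[of i n])
qed

lemma degree_Z_poly: "degree (Z_poly l m n) = n"
  by (rule antisym, rule degree_le, simp add: coeff_Z_poly, rule le_degree, simp add: coeff_Z_poly)

text \<open>The difference of the powers is a multiple of \<open>l - (l - m) = m\<close>, hence of
  4. Adding it to the sum leaves \<open>2 * l ^ n\<close> with \<open>l ^ n\<close> odd.\<close>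

lemma not_four_dvd_sum_powers:
  fixes l m :: int
  assumes "odd l" "4 dvd m"
  shows "\<not> 4 dvd l ^ n + (l - m) ^ n"
proof
  assume "4 dvd l ^ n + (l - m) ^ n"
  moreover have "4 dvd l ^ n - (l - m) ^ n"
    using dvd_trans[OF \<open>4 dvd m\<close>, of "l ^ n - (l - m) ^ n"]
    by (simp add: power_diff_sumr2[of l n "l - m"])
  ultimately have "4 dvd 2 * l ^ n"
    using dvd_add by fastforce
  hence "2 * 2 dvd 2 * l ^ n" by simp
  hence "2 dvd l ^ n"
    by (subst (asm) dvd_mult_cancel_left) simp
  with \<open>odd l\<close> show False by simp
qed

theorem theorem12:
  fixes l m :: int and n :: nat
  assumes "l > m" and "m > 0" and "gcd l m = 1" and "n \<ge> 1"
    and "singly_even (2 * l - m)"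
  shows "irreducible_over_Z (Z_poly l m n)"
proof -
  have "even m" and "\<not> 4 dvd 2 * l - m"
    using assms(5) by (auto simp: singly_even_def)
  with \<open>gcd l m = 1\<close> have "odd l"
    by (metis gcd_greatest odd_one)
  \<comment> \<open>Both \<open>2 * l\<close> and \<open>2 * l - m\<close> are 2 modulo 4.\<close>
  with \<open>even m\<close> \<open>\<not> 4 dvd 2 * l - m\<close> have "4 dvd m"
    by presburger
  have "degree g = 0 \<or> degree h = 0" if "Z_poly l m n = g * h" for g h
  proof (rule Eisenstein_criterion[of 2], unfold that[symmetric] degree_Z_poly)
    show "prime_elem (2 :: int)"
      by (auto simp: prime_elem_def)
    show "\<not> 2 dvd coeff (Z_poly l m n) n"
      by (simp add: coeff_Z_poly)
    show "2 dvd coeff (Z_poly l m n) i" if "i < n" for i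
      using that \<open>odd l\<close> \<open>even m\<close> by (simp add: coeff_Z_poly)
    show "\<not> 2\<^sup>2 dvd coeff (Z_poly l m n) 0"
      using \<open>n \<ge> 1\<close> not_four_dvd_sum_powers[OF \<open>odd l\<close> \<open>4 dvd m\<close>, of n]
      by (cases "even n") (auto simp: coeff_Z_poly simp del: minus_add_distrib)
  qed
  thus ?thesis
    by (auto simp: irreducible_over_Z_def reducible_over_Z_def)
qed

end
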